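(* Let $\breve{\mathbf{M}}\in\mathbb{H}_S^{m\times n}$ be an $r$-separable quaternion matrix all of whose columns are nonzero. If $\operatorname{rank}(\operatorname{Mat}(\breve{\mathbf{M}}))=r$, then the quaternion successive projection algorithm (quaternion SPA, described in the context), applied to $\breve{\mathbf{M}}$ and $r$, identifies the column set correctly: it outputs a set $\mathcal{K}$ of $r$ indices such that $\breve{\mathbf{M}}=\breve{\mathbf{M}}(:,\mathcal{K})\mathbf{H}$ for some $\mathbf{H}\in\mathbb{R}^{r\times n}_+$.
   Context: $\mathbb{H}$ denotes the quaternions $\breve q=q_0+\mathtt{i}q_1+\mathtt{j}q_2+\mathtt{k}q_3$ with $q_0,\dots,q_3\in\mathbb{R}$, and $\mathcal{S}_l(\breve q)=q_l$ for $l=0,1,2,3$, applied entrywise to quaternion vectors and matrices. $\mathbb{H}_S=\{\breve q\in\mathbb{H}: q_0\ge 0,\ q_1^2+q_2^2+q_3^2\le q_0^2\}$, and $\mathbb{H}_S^{m\times n}$ is the set of $m\times n$ matrices with entries in $\mathbb{H}_S$. $\mathbf{A}(:,\mathcal{J})$ is the submatrix of columns indexed by $\mathcal{J}$. For $\breve{\mathbf{Q}}\in\mathbb{H}^{m\times n}$, $\operatorname{Mat}(\breve{\mathbf{Q}})\in\mathbb{R}^{4m\times n}$ is the vertical stack of $\mathcal{S}_0(\breve{\mathbf{Q}}),\mathcal{S}_1(\breve{\mathbf{Q}}),\mathcal{S}_2(\breve{\mathbf{Q}}),\mathcal{S}_3(\breve{\mathbf{Q}})$. For $\breve{\mathbf{a}},\breve{\mathbf{b}}\in\mathbb{H}^m$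 the (real-valued) inner product is $\langle\breve{\mathbf{a}},\breve{\mathbf{b}}\rangle=\sum_{l=0}^3\mathcal{S}_l(\breve{\mathbf{a}})^T\mathcal{S}_l(\breve{\mathbf{b}})$ and $\|\breve{\mathbf{a}}\|_2=\langle\breve{\mathbf{a}},\breve{\mathbf{a}}\rangle^{1/2}$. A matrix $\breve{\mathbf{M}}\in\mathbb{H}_S^{m\times n}$ is $r$-separable if there are an index set $\mathcal{K}\subseteq\{1,\dots,n\}$ with $|\mathcal{K}|=r$ and an entrywise nonnegative $\mathbf{H}\in\mathbb{R}^{r\times n}_+$ such that $\breve{\mathbf{M}}=\breve{\mathbf{M}}(:,\mathcal{K})\mathbf{H}$, and $r$ is the minimal number for which such a factorization exists. Quaternion SPA. Input: $\breve{\mathbf{M}}=[\breve{\mathbf{m}}_1,\dots,\breve{\mathbf{m}}_n]\in\mathbb{H}_S^{m\times n}$ and $r$. 1. Normalization: replace each column $\breve{\mathbf{m}}_j$ by $\breve{\mathbf{m}}_j/\|\mathcal{S}_0(\breve{\mathbf{m}}_j)\|_1$. 2. Set $\breve{\mathbf{Z}}=[\breve{\mathbf{z}}_1,\dots,\breve{\mathbf{z}}_n]$ equal to the normalized matrix and $\mathcal{K}=\emptyset$. 3. Repeat $r$ times: choose $k\in\arg\max_j\|\breve{\mathbf{z}}_j\|_2$; set $\mathbf{p}=(\langle\breve{\mathbf{z}}_k,\breve{\mathbf{z}}_1\rangle,\dots,\langle\breve{\mathbf{z}}_k,\breve{\mathbf{z}}_n\rangle)^T\in\mathbb{R}^n$;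 replace $\breve{\mathbf{Z}}$ by $\breve{\mathbf{Z}}-\breve{\mathbf{z}}_k\mathbf{p}^T/\|\breve{\mathbf{z}}_k\|_2^2$; replace $\mathcal{K}$ by $\mathcal{K}\cup\{k\}$. Output: $\mathcal{K}$. (Ties in the $\arg\max$ are broken arbitrarily.) *)

theory Defs
  imports "HOL-Analysis.Analysis"
begin

datatype quat = Quat (quat_re: real) (quat_i: real) (quat_j: real) (quat_k: real)

lemma quat_eq_iff:
  "p = q \<longleftrightarrow> quat_re p = quat_re q \<and> quat_i p = quat_i q \<and>
    quat_j p = quat_j q \<and> quat_k p = quat_k q"
  by (cases p; cases q) simp

instantiation quat :: real_algebra_1
begin

definition "0 = Quat 0 0 0 0"

definition "1 = Quat 1 0 0 0"

definition "p + q = Quat (quat_re p + quat_re q) (quat_i p + quat_i q)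
  (quat_j p + quat_j q) (quat_k p + quat_k q)"

definition "p - q = Quat (quat_re p - quat_re q) (quat_i p - quat_i q)
  (quat_j p - quat_j q) (quat_k p - quat_k q)"

definition "- q = Quat (- quat_re q) (- quat_i q) (- quat_j q) (- quat_k q)"

definition "p * q = Quat
  (quat_re p * quat_re q - quat_i p * quat_i q - quat_j p * quat_j q - quat_k p * quat_k q)
  (quat_re p * quat_i q + quat_i p * quat_re q + quat_j p * quat_k q - quat_k p * quat_j q)
  (quat_re p * quat_j q - quat_i p * quat_k q + quat_j p * quat_re q + quat_k p * quat_i q)
  (quat_re p * quat_k q + quat_i p * quat_j q - quat_j p * quat_i q + quat_k p * quat_re q)"

definition "c *\<^sub>R q = Quat (c * quat_re q) (c * quat_i q) (c * quat_j q) (c * quat_k q)"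

instance
  by standard
    (simp_all add: quat_eq_iff zero_quat_def one_quat_def plus_quat_def minus_quat_def
      uminus_quat_def times_quat_def scaleR_quat_def algebra_simps)

end

instantiation quat :: real_inner
begin

definition "inner p q = quat_re p * quat_re q + quat_i p * quat_i q
  + quat_j p * quat_j q + quat_k p * quat_k q"

definition norm_quat :: "quat \<Rightarrow> real"
  where "norm_quat q = sqrt (inner q q)"

definition sgn_quat :: "quat \<Rightarrow> quat"
  where "sgn_quat q = q /\<^sub>R norm q"

definition dist_quat :: "quat \<Rightarrow> quat \<Rightarrow> real"
  where "dist_quat p q = norm (p - q)"

definition uniformity_quat :: "(quat \<times> quat) filter"
  where "uniformity_quat = (INF e\<in>{0<..}. principal {(x, y). dist x y < e})"

definition open_quat :: "quat set \<Rightarrow> bool"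
  where "open_quat U \<longleftrightarrow>
    (\<forall>x\<in>U. eventually (\<lambda>(x', y). x' = x \<longrightarrow> y \<in> U) uniformity)"

instance
proof
  fix p q r :: quat and c :: real
  show "dist p q = norm (p - q)" by (fact dist_quat_def)
  show "sgn p = p /\<^sub>R norm p" by (fact sgn_quat_def)
  show "uniformity = (INF e\<in>{0<..}. principal {(x::quat, y). dist x y < e})"
    by (fact uniformity_quat_def)
  show "open U \<longleftrightarrow> (\<forall>x\<in>U. eventually (\<lambda>(x', y). x' = x \<longrightarrow> y \<in> U) uniformity)"
    for U :: "quat set" by (fact open_quat_def)
  show "inner p q = inner q p" by (simp add: inner_quat_def algebra_simps)
  show "inner (p + q) r = inner p r + inner q r"
    by (simp add: inner_quat_def plus_quat_def algebra_simps)
  show "inner (c *\<^sub>R p) q = c * inner p q"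
    by (simp add: inner_quat_def scaleR_quat_def algebra_simps)
  show "0 \<le> inner p p" by (simp add: inner_quat_def)
  have "a * a + b * b + c * c + d * d = 0 \<longleftrightarrow> a = 0 \<and> b = 0 \<and> c = 0 \<and> d = 0"
    for a b c d :: real
    by (metis add_nonneg_eq_0_iff add_nonneg_nonneg mult_eq_0_iff zero_le_square)
  then show "inner p p = 0 \<longleftrightarrow> p = 0"
    by (simp add: inner_quat_def quat_eq_iff zero_quat_def)
  show "norm p = sqrt (inner p p)" by (fact norm_quat_def)
qed

end

text \<open>
  The component maps \<open>S\<^sub>0, \<dots>, S\<^sub>3\<close>, indexed by the four-element type whose elements
  are \<open>0, 1, 2, 3\<close>.
\<close>

definition quat_part :: "4 \<Rightarrow> quat \<Rightarrow> real" where
  "quat_part l q =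
    (if l = 0 then quat_re q else if l = 1 then quat_i q else if l = 2 then quat_j q else quat_k q)"

text \<open>
  The inner product and norm on quaternion vectors are those the library provides on
  \<^typ>\<open>quat ^ 'm\<close>; they are the real-valued ones, summed over the four components.
\<close>

lemma inner_quat_vec:
  fixes a b :: "quat ^ 'm"
  shows "a \<bullet> b = (\<Sum>l\<in>UNIV. (\<chi> i. quat_part l (a $ i)) \<bullet> (\<chi> i. quat_part l (b $ i)))"
  by (simp add: inner_vec_def inner_quat_def sum_4 quat_part_def sum.distrib)

definition H_S :: "quat set" where
  "H_S = {q. 0 \<le> quat_re q \<and>
    (quat_i q)\<^sup>2 + (quat_j q)\<^sup>2 + (quat_k q)\<^sup>2 \<le> (quat_re q)\<^sup>2}"

definition H_S_mat :: "(quat ^ 'n ^ 'm) set" where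
  "H_S_mat = {M. \<forall>i j. M $ i $ j \<in> H_S}"

text \<open>
  The vertical stack of the four component matrices: row \<open>(l, i)\<close> is row \<open>i\<close> of block \<open>l\<close>.
\<close>

definition Mat :: "quat ^ 'n ^ 'm \<Rightarrow> real ^ 'n ^ (4 \<times> 'm)" where
  "Mat Q = (\<chi> li j. quat_part (fst li) (Q $ snd li $ j))"

text \<open>
  The product \<open>M(:,K) H\<close>. The rows of the real \<open>|K| \<times> n\<close> matrix \<open>H\<close> are labelled by the elements
  of \<open>K\<close> instead of \<open>1, \<dots>, |K|\<close>; values of \<open>H\<close> at row labels outside \<open>K\<close> play no role.
\<close>

definition cols_mult :: "quat ^ 'n ^ 'm \<Rightarrow> 'n set \<Rightarrow> ('n \<Rightarrow> 'n \<Rightarrow> real) \<Rightarrow> quat ^ 'n ^ 'm" where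
  "cols_mult M K H = (\<chi> i j. \<Sum>k\<in>K. H k j *\<^sub>R M $ i $ k)"

definition separable_via :: "quat ^ 'n ^ 'm \<Rightarrow> 'n set \<Rightarrow> bool" where
  "separable_via M K \<longleftrightarrow> (\<exists>H. (\<forall>k\<in>K. \<forall>j. 0 \<le> H k j) \<and> M = cols_mult M K H)"

definition separable :: "nat \<Rightarrow> quat ^ 'n ^ 'm \<Rightarrow> bool" where
  "separable r M \<longleftrightarrow>
    (\<exists>K. card K = r \<and> separable_via M K) \<and> (\<forall>K. separable_via M K \<longrightarrow> r \<le> card K)"

definition normalize_cols :: "quat ^ 'n ^ 'm \<Rightarrow> quat ^ 'n ^ 'm" where
  "normalize_cols M = (\<chi> i j. M $ i $ j /\<^sub>R (\<Sum>i'\<in>UNIV. \<bar>quat_part 0 (M $ i' $ j)\<bar>))"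

definition project_out :: "'n \<Rightarrow> quat ^ 'n ^ 'm \<Rightarrow> quat ^ 'n ^ 'm" where
  "project_out k Z = (\<chi> i j. Z $ i $ j -
    ((column k Z \<bullet> column j Z) / (norm (column k Z))\<^sup>2) *\<^sub>R Z $ i $ k)"

text \<open>
  \<open>spa_run Z\<^sub>0 t Z K\<close>: starting from the normalized matrix \<open>Z\<^sub>0\<close>, the loop body can be executed
  \<open>t\<close> times so that the residual is then \<open>Z\<close> and the set of chosen indices is \<open>K\<close>. This is a
  relation because any maximizer may be chosen in each iteration.
\<close>

inductive spa_run :: "quat ^ 'n ^ 'm \<Rightarrow> nat \<Rightarrow> quat ^ 'n ^ 'm \<Rightarrow> 'n set \<Rightarrow> bool"
  for Z\<^sub>0 :: "quat ^ 'n ^ 'm" where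
  init: "spa_run Z\<^sub>0 0 Z\<^sub>0 {}"
| step: "spa_run Z\<^sub>0 t Z K \<Longrightarrow> is_arg_max (\<lambda>j. norm (column j Z)) (\<lambda>j. True) k
    \<Longrightarrow> spa_run Z\<^sub>0 (Suc t) (project_out k Z) (insert k K)"

definition spa_output :: "quat ^ 'n ^ 'm \<Rightarrow> nat \<Rightarrow> 'n set \<Rightarrow> bool" where
  "spa_output M r K \<longleftrightarrow> (\<exists>Z. spa_run (normalize_cols M) r Z K)"

end

theory Submission
  imports Defs
begin

text \<open>
  Normalization puts every column into the convex hull of the columns \<open>V\<close> indexed by the
  separating set, and the rank condition makes \<open>V\<close> linearly independent. After each step the
  residual is the image of the normalized matrix under a linear map \<open>P\<close> whose kernel is the span
  of the columns chosen so far. A column whose residual has maximal nonzero norm is a convex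
  combination of elements of \<open>V\<close>; by strict convexity of the norm, \<open>P\<close> takes the same nonzero
  value on all elements occurring with positive weight, and independence leaves room for only
  one of them. So each step picks a new element of \<open>V\<close>, and after \<open>r\<close> steps all are found.
\<close>

section \<open>Maximal norm in convex combinations\<close>

text \<open>Cauchy-Schwarz bounds each \<open>f w \<bullet> x\<close> by
  \<open>x \<bullet> x\<close>, and the weighted average of these bounds is an equality. So equality
  holds wherever the weight is positive, and with the norm bound it forces \<open>f v - x\<close> to
  vanish.\<close>

lemma convex_combination_norm_max:
  fixes f :: "'b \<Rightarrow> 'a::real_inner"
  assumes "finite S" "\<And>v. v \<in> S \<Longrightarrow> 0 \<le> u v" "sum u S = 1"
    and x: "x = (\<Sum>v\<in>S. u v *\<^sub>R f v)"
    and le: "\<And>v. v \<in> S \<Longrightarrow> norm (f v) \<le> norm x"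
    and "v \<in> S" "0 < u v"
  shows "f v = x"
proof -
  have ip: "f w \<bullet> x \<le> x \<bullet> x" if "w \<in> S" for w
  proof -
    have "f w \<bullet> x \<le> norm (f w) * norm x" by (rule norm_cauchy_schwarz)
    also have "\<dots> \<le> norm x * norm x" using le[OF that] by (intro mult_right_mono) auto
    finally show ?thesis by (simp add: dot_square_norm power2_eq_square)
  qed
  have "(\<Sum>w\<in>S. u w * (x \<bullet> x - f w \<bullet> x)) = sum u S * (x \<bullet> x) - (\<Sum>w\<in>S. u w *\<^sub>R f w) \<bullet> x"
    by (simp add: inner_sum_left sum_distrib_right sum_subtractf right_diff_distrib)
  also have "\<dots> = 0" using assms(3) x by simp
  finally have "u v * (x \<bullet> x - f v \<bullet> x) = 0"
    using sum_nonneg_eq_0_iff[of S "\<lambda>w. u w * (x \<bullet> x - f w \<bullet> x)"] assms(1,2,6) ip by simp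
  then have eq: "f v \<bullet> x = x \<bullet> x" using \<open>0 < u v\<close> by simp
  have "(norm (f v - x))\<^sup>2 = f v \<bullet> f v - x \<bullet> x"
    using eq by (simp add: power2_norm_eq_inner inner_diff_left inner_diff_right inner_commute)
  also have "\<dots> \<le> 0"
    using le[OF \<open>v \<in> S\<close>] by (simp add: norm_le)
  finally show ?thesis by simp
qed

text \<open>Two elements of \<open>V\<close> with positive weight in \<open>x\<close> have the same
  image under \<open>P\<close>, so their difference lies in \<open>span W\<close>. This contradicts
  independence, hence all the weight sits on one element.\<close>

lemma norm_max_in_independent:
  fixes V :: "'a::real_inner set"
  assumes "finite V" "independent V" "W \<subseteq> V"
    and "linear P" and P0: "\<And>w. w \<in> W \<Longrightarrow> P w = 0" and Pker: "\<And>y. y - P y \<in> span W"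
    and x: "x \<in> convex hull V" and "P x \<noteq> 0"
    and le: "\<And>v. v \<in> V \<Longrightarrow> norm (P v) \<le> norm (P x)"
  shows "x \<in> V - W"
proof -
  interpret P: linear P by fact
  obtain u where u: "\<And>v. v \<in> V \<Longrightarrow> 0 \<le> u v" "sum u V = 1" and xu: "(\<Sum>v\<in>V. u v *\<^sub>R v) = x"
    using x convex_hull_finite[OF \<open>finite V\<close>] by auto
  have "P x = (\<Sum>v\<in>V. u v *\<^sub>R P v)"
    unfolding xu[symmetric] by (simp add: P.sum P.scale)
  then have eq: "P v = P x" if "v \<in> V" "0 < u v" for v
    using convex_combination_norm_max[OF \<open>finite V\<close> u, of "P x" P v] le that by blast
  have "\<exists>v\<in>V. u v \<noteq> 0"
    using u(2) by (metis sum.neutral zero_neq_one)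
  then obtain v where v: "v \<in> V" "0 < u v" using u(1) by (metis order_less_le)
  have uniq: "v' = v" if "v' \<in> V" "0 < u v'" for v'
  proof (rule ccontr)
    assume "v' \<noteq> v"
    have "P (v' - v) = 0" using eq that v by (simp add: P.diff)
    then have "v' - v \<in> span W" using Pker[of "v' - v"] by simp
    then have "v' \<in> span (insert v W)"
      by (auto simp: span_breakdown_eq intro!: exI[of _ 1])
    \<comment> \<open>Here \<open>v'\<close> is outside \<open>W\<close>, since \<open>P\<close>
      vanishes on \<open>W\<close> but \<open>P v' = P x\<close> is nonzero.\<close>
    moreover have "insert v W \<subseteq> V - {v'}"
      using v \<open>v' \<noteq> v\<close> \<open>W \<subseteq> V\<close> P0 eq[OF that] \<open>P x \<noteq> 0\<close> by auto
    ultimately have "v' \<in> span (V - {v'})" using span_mono by blast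
    then show False using \<open>independent V\<close> that(1) unfolding dependent_def by blast
  qed
  have zero: "u w = 0" if "w \<in> V - {v}" for w
    using that u(1) uniq by (metis Diff_iff insertCI order_less_le)
  have "sum u V = u v"
    using sum.remove[OF \<open>finite V\<close> v(1), of u] zero by simp
  then have "x = v"
    using xu u(2) sum.remove[OF \<open>finite V\<close> v(1), of "\<lambda>v. u v *\<^sub>R v"] zero by simp
  then show ?thesis using v(1) P0 \<open>P x \<noteq> 0\<close> by auto
qed

section \<open>Runs of the algorithm\<close>

lemma column_project_out:
  "column j (project_out k Z) = column j Z -
    ((column k Z \<bullet> column j Z) / (norm (column k Z))\<^sup>2) *\<^sub>R column k Z"
  by (simp add: vec_eq_iff column_def project_out_def)

lemma spa_run_exists: "\<exists>Z K. spa_run Z0 t Z K"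
proof (induction t)
  case 0
  show ?case using spa_run.init by blast
next
  case (Suc t)
  then obtain Z K where run: "spa_run Z0 t Z K" by blast
  have "Max (range (\<lambda>j. norm (column j Z))) \<in> range (\<lambda>j. norm (column j Z))"
    by (intro Max_in) auto
  then obtain k where k: "norm (column k Z) = Max (range (\<lambda>j. norm (column j Z)))"
    by (metis (no_types, lifting) imageE)
  have "is_arg_max (\<lambda>j. norm (column j Z)) (\<lambda>j. True) k"
    unfolding is_arg_max_def k by (auto simp: not_less intro!: Max_ge)
  then show ?case using spa_run.step[OF run] by blast
qed

text \<open>The two span conditions on \<open>P\<close> together say that its kernel is the span of
  the chosen columns. Injectivity is carried along because different indices may have equal columns;
  it makes the count of chosen indices a count of elements of \<open>V\<close>.\<close>

lemma spa_run_invariant: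
  fixes Z0 :: "quat ^ 'n ^ 'm"
  assumes run: "spa_run Z0 t Z K"
    and "independent V" "finite V" and V: "V \<subseteq> range (\<lambda>j. column j Z0)"
    and hull: "\<And>j. column j Z0 \<in> convex hull V"
    and "t \<le> card V"
  shows "\<exists>P. linear P \<and> (\<forall>k\<in>K. P (column k Z0) = 0)
      \<and> (\<forall>x. x - P x \<in> span ((\<lambda>j. column j Z0) ` K)) \<and> (\<forall>j. column j Z = P (column j Z0))
      \<and> inj_on (\<lambda>j. column j Z0) K \<and> (\<lambda>j. column j Z0) ` K \<subseteq> V \<and> card K = t"
  using run \<open>t \<le> card V\<close>
proof (induction rule: spa_run.induct)
  case init
  show ?case by (rule exI[of _ id]) (auto simp: linear_id id_def[symmetric])
next
  case (step t Z K k)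
  let ?z = "\<lambda>j. column j Z0"
  obtain P where "linear P" and P0: "\<And>k. k \<in> K \<Longrightarrow> P (?z k) = 0"
    and Pker: "\<And>x. x - P x \<in> span (?z ` K)" and PZ: "\<And>j. column j Z = P (?z j)"
    and inj: "inj_on ?z K" and KV: "?z ` K \<subseteq> V" and card: "card K = t"
    using step by auto
  interpret P: linear P by fact
  have kmax: "norm (P (?z j)) \<le> norm (P (?z k))" for j
    using step.hyps(2) by (auto simp: is_arg_max_def PZ not_less)
  have "card (?z ` K) < card V"
    using card_image[OF inj] card step.prems by simp
  then obtain v where v: "v \<in> V" "v \<notin> ?z ` K"
    using KV by (metis less_irrefl subsetI subset_antisym)
  \<comment> \<open>An unchosen element of \<open>V\<close> keeps a nonzero residual, so the maximal
    residual is nonzero too.\<close>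
  have "P v \<noteq> 0"
  proof
    assume "P v = 0"
    then have "v \<in> span (?z ` K)" using Pker[of v] by simp
    moreover have "?z ` K \<subseteq> V - {v}" using KV v by auto
    ultimately have "v \<in> span (V - {v})" using span_mono by blast
    then show False using \<open>independent V\<close> v(1) unfolding dependent_def by blast
  qed
  then have nz: "P (?z k) \<noteq> 0" using kmax V v(1) by fastforce
  have new: "?z k \<in> V - ?z ` K"
    by (rule norm_max_in_independent[OF \<open>finite V\<close> \<open>independent V\<close> KV \<open>linear P\<close> _ Pker hull nz])
      (use P0 kmax V in auto)
  let ?w = "P (?z k)"
  \<comment> \<open>\<open>P\<close> followed by the orthogonal projection that removes the
    direction \<open>?w\<close>, exactly as \<open>project_out\<close> acts on the residual
    columns.\<close>
  define P' where "P' x = P x - ((?w \<bullet> P x) / (norm ?w)\<^sup>2) *\<^sub>R ?w" for x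
  have "linear P'"
    by (rule linearI) (simp_all add: P'_def P.add P.scale inner_add_right add_divide_distrib
        scaleR_add_left scaleR_diff_right)
  moreover have "P' (?z j) = 0" if "j \<in> insert k K" for j
    using that nz P0 by (auto simp: P'_def power2_norm_eq_inner)
  moreover have "x - P' x \<in> span (?z ` insert k K)" for x
  proof -
    have sub: "y - P y \<in> span (?z ` insert k K)" for y
      using Pker[of y] span_mono[of "?z ` K" "?z ` insert k K"] by auto
    \<comment> \<open>This difference is \<open>?w\<close>, written so that the property of
      \<open>P\<close> places it in the span.\<close>
    have "?z k - (?z k - ?w) \<in> span (?z ` insert k K)"
      by (intro span_diff sub span_base) auto
    then have "(x - P x) + ((?w \<bullet> P x) / (norm ?w)\<^sup>2) *\<^sub>R ?w \<in> span (?z ` insert k K)"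
      by (intro span_add sub span_scale) simp
    then show ?thesis by (simp add: P'_def algebra_simps)
  qed
  moreover have "column j (project_out k Z) = P' (?z j)" for j
    by (simp add: column_project_out PZ P'_def)
  moreover have "inj_on ?z (insert k K)" "?z ` insert k K \<subseteq> V"
    using inj new KV by auto
  moreover have "k \<notin> K" using new by auto
  then have "card (insert k K) = Suc t" using card by simp
  ultimately show ?case by blast
qed

lemma spa_run_columns:
  assumes "spa_run Z0 (card V) Z K" and "independent V" "finite V"
    and "V \<subseteq> range (\<lambda>j. column j Z0)" and "\<And>j. column j Z0 \<in> convex hull V"
  shows "inj_on (\<lambda>j. column j Z0) K" "(\<lambda>j. column j Z0) ` K = V" "card K = card V"
proof -
  have *: "inj_on (\<lambda>j. column j Z0) K" "(\<lambda>j. column j Z0) ` K \<subseteq> V" "card K = card V"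
    using spa_run_invariant[OF assms order_refl] by blast+
  then show "inj_on (\<lambda>j. column j Z0) K" "card K = card V" by auto
  show "(\<lambda>j. column j Z0) ` K = V"
    using * by (intro card_subset_eq \<open>finite V\<close>) (auto simp: card_image)
qed

section \<open>Real coordinates and rank\<close>

text \<open>Uses the row labels of \<open>Mat\<close>, so that the rank of the real matrix can be
  read as a statement about quaternion columns.\<close>

definition vec_parts :: "quat ^ 'm \<Rightarrow> real ^ (4 \<times> 'm)" where
  "vec_parts v = (\<chi> li. quat_part (fst li) (v $ snd li))"

lemma linear_vec_parts: "linear vec_parts"
  by (rule linearI)
    (auto simp: vec_parts_def vec_eq_iff quat_part_def plus_quat_def scaleR_quat_def)

lemma column_Mat: "column j (Mat M) = vec_parts (column j M)"
  by (simp add: column_def Mat_def vec_parts_def)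

text \<open>In real coordinates the vectors \<open>z k\<close> span a space of dimension at least
  \<open>card K\<close>, so they are distinct and form a basis; both properties pull back along
  \<open>vec_parts\<close>. The general \<open>z\<close> allows rescaled columns.\<close>

lemma inj_independent_columns:
  fixes M :: "quat ^ 'n ^ 'm" and z :: "'k::finite \<Rightarrow> quat ^ 'm"
  assumes "card K \<le> rank (Mat M)"
    and "\<And>k. k \<in> K \<Longrightarrow> z k \<in> span (columns M)" and sp: "\<And>j. column j M \<in> span (z ` K)"
  shows "inj_on z K" "independent (z ` K)"
proof -
  let ?B = "vec_parts ` z ` K"
  have cols: "columns (Mat M) = vec_parts ` columns M"
    by (auto simp: columns_def column_Mat)
  have fin: "finite ?B" by simp
  have "vec_parts (column j M) \<in> span ?B" for j
    unfolding linear_span_image[OF linear_vec_parts] by (rule imageI[OF sp])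
  then have "columns (Mat M) \<subseteq> span ?B"
    by (auto simp: columns_def column_Mat)
  then have sub: "span (columns (Mat M)) \<subseteq> span ?B"
    by (simp add: span_minimal)
  have B: "?B \<subseteq> span (columns (Mat M))"
    using assms(2) by (auto simp: cols linear_span_image[OF linear_vec_parts])
  have dim: "rank (Mat M) = dim (span (columns (Mat M)))"
    by (simp add: column_rank_def)
  have "card K \<le> card ?B"
    using assms(1) dim dim_le_card[OF sub fin] by simp
  then have cardB: "card (vec_parts ` z ` K) = card K"
    using card_image_le[of K "vec_parts \<circ> z"] by (simp add: image_comp)
  have inj: "inj_on (vec_parts \<circ> z) K"
    using cardB by (intro eq_card_imp_inj_on) (auto simp: image_comp)
  then show "inj_on z K" by (rule inj_on_imageI2)
  have "independent ?B"
    using card_le_dim_spanning[OF B sub fin] cardB assms(1) dim by simp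
  then show "independent (z ` K)"
    unfolding dependent_def
  proof (elim contrapos_nn bexE)
    fix a
    assume a: "a \<in> z ` K" "a \<in> span (z ` K - {a})"
    \<comment> \<open>Injectivity of \<open>vec_parts\<close> on these vectors keeps the images of
      the others away from that of \<open>a\<close>.\<close>
    have "vec_parts ` (z ` K - {a}) \<subseteq> ?B - {vec_parts a}"
      using inj_on_imageI[OF inj] a(1) by (auto dest: inj_onD)
    moreover have "vec_parts a \<in> span (vec_parts ` (z ` K - {a}))"
      using a(2) by (simp add: linear_span_image[OF linear_vec_parts])
    ultimately have "vec_parts a \<in> span (?B - {vec_parts a})" using span_mono by blast
    then show "\<exists>a\<in>?B. a \<in> span (?B - {a})" using a(1) by blast
  qed
qed

section \<open>Normalization and separability\<close>

lemma column_normalize_cols: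
  "column j (normalize_cols M) = column j M /\<^sub>R (\<Sum>i\<in>UNIV. \<bar>quat_re (M $ i $ j)\<bar>)"
  by (simp add: vec_eq_iff column_def normalize_cols_def quat_part_def)

lemma cols_mult_iff:
  "M = cols_mult M K H \<longleftrightarrow> (\<forall>j. column j M = (\<Sum>k\<in>K. H k j *\<^sub>R column k M))"
  by (auto simp: cols_mult_def vec_eq_iff column_def)

text \<open>In \<open>H_S\<close> a zero real part forces the whole entry to vanish. This makes the
  normalizing divisors positive.\<close>

lemma quat_re_sum_pos:
  assumes "M \<in> H_S_mat" "column j M \<noteq> 0"
  shows "0 < (\<Sum>i\<in>UNIV. \<bar>quat_re (M $ i $ j)\<bar>)"
proof -
  obtain i where "M $ i $ j \<noteq> 0" using assms(2) by (auto simp: vec_eq_iff column_def)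
  moreover have "M $ i $ j \<in> H_S" using assms(1) by (auto simp: H_S_mat_def)
  ultimately have "quat_re (M $ i $ j) \<noteq> 0"
    by (auto simp: H_S_def quat_eq_iff zero_quat_def sum_power2_le_zero_iff
      add_nonneg_eq_0_iff sum_power2_eq_zero_iff order_antisym_conv)
  then show ?thesis by (intro sum_pos2[of _ i]) auto
qed

theorem theorem1:
  fixes M :: "quat ^ 'n ^ 'm" and r :: nat
  assumes "M \<in> H_S_mat"
    and "separable r M"
    and "\<forall>j. column j M \<noteq> 0"
    and "rank (Mat M) = r"
  shows "(\<exists>K. spa_output M r K) \<and>
    (\<forall>K. spa_output M r K \<longrightarrow>
      card K = r \<and> (\<exists>H. (\<forall>k\<in>K. \<forall>j. 0 \<le> H k j) \<and> M = cols_mult M K H))"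
proof -
  define s where "s j = (\<Sum>i\<in>UNIV. \<bar>quat_re (M $ i $ j)\<bar>)" for j
  define z where "z j = column j (normalize_cols M)" for j
  have s: "0 < s j" for j
    unfolding s_def using quat_re_sum_pos assms(1,3) by blast
  have zM: "z j = column j M /\<^sub>R s j" for j
    by (simp add: z_def s_def column_normalize_cols)
  have Mz: "column j M = s j *\<^sub>R z j" for j
    using s[of j] by (simp add: zM)
  obtain K0 H where K0: "card K0 = r" and H: "\<And>k j. k \<in> K0 \<Longrightarrow> 0 \<le> H k j"
    and MH: "\<And>j. column j M = (\<Sum>k\<in>K0. H k j *\<^sub>R column k M)"
    using assms(2) cols_mult_iff[of M] unfolding separable_def separable_via_def by metis
  let ?V = "z ` K0"
  have ind: "inj_on z K0" "independent ?V"
  proof -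
    have "z k \<in> span (columns M)" for k
      unfolding zM by (intro span_scale span_base) (auto simp: columns_def)
    moreover have "column j M \<in> span ?V" for j
      unfolding MH[of j] by (intro span_sum span_scale) (auto simp: Mz intro: span_base span_scale)
    ultimately show "inj_on z K0" "independent ?V"
      using inj_independent_columns[of K0 M z] K0 assms(4) by auto
  qed
  have cardV: "card ?V = r" using ind(1) K0 by (simp add: card_image)
  have hull: "z j \<in> convex hull ?V" for j
  proof -
    \<comment> \<open>The total real part equals 1 on every normalized column, so applying it to a
      combination of such columns yields the sum of the weights.\<close>
    define L :: "quat ^ 'm \<Rightarrow> real" where "L x = (\<Sum>i\<in>UNIV. quat_re (x $ i))" for x
    interpret L: linear L
      by (rule linearI) (auto simp: L_def plus_quat_def scaleR_quat_def sum.distrib sum_distrib_left)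
    have "L (column i M) = s i" for i
      using assms(1) by (auto simp: L_def s_def column_def H_S_mat_def H_S_def intro!: sum.cong)
    then have Lz: "L (z i) = 1" for i
      using s[of i] by (simp add: zM L.scale)
    \<comment> \<open>The weights of \<open>H\<close>, rescaled from the columns of \<open>M\<close>
      to the normalized ones.\<close>
    define h where "h k = H k j * s k / s j" for k
    have zh: "z j = (\<Sum>k\<in>K0. h k *\<^sub>R z k)"
    proof -
      have "s j *\<^sub>R z j = s j *\<^sub>R (\<Sum>k\<in>K0. h k *\<^sub>R z k)"
        using MH[of j] s[of j] by (simp add: Mz scaleR_sum_right h_def)
      then show ?thesis using s[of j] by simp
    qed
    then have "L (z j) = (\<Sum>k\<in>K0. h k * L (z k))" by (simp add: L.sum L.scale)
    then have "sum h K0 = 1" by (simp add: Lz)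
    then show ?thesis
      unfolding zh using H s
      by (intro convex_sum convex_convex_hull) (auto simp: h_def hull_inc less_imp_le)
  qed
  show ?thesis
  proof (intro conjI allI impI)
    show "\<exists>K. spa_output M r K"
      using spa_run_exists unfolding spa_output_def by blast
  next
    fix K
    assume "spa_output M r K"
    then obtain Z where "spa_run (normalize_cols M) (card ?V) Z K"
      using cardV unfolding spa_output_def by blast
    from spa_run_columns[OF this ind(2)] hull
    have K: "inj_on z K" "z ` K = ?V" "card K = r"
      using cardV unfolding z_def by auto
    show "card K = r" by fact
    \<comment> \<open>\<open>K\<close> may differ from \<open>K0\<close>, since columns can coincide
      after normalization; only their images under \<open>z\<close> agree, so the weights are taken
      on that image.\<close>
    have "\<exists>u. (\<forall>v\<in>z ` K. 0 \<le> u v) \<and> sum u (z ` K) = 1 \<and> (\<Sum>v\<in>z ` K. u v *\<^sub>R v) = z j" for j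
      using hull[of j] convex_hull_finite[of "z ` K"] K(2) by auto
    then obtain u where u: "\<And>j v. v \<in> z ` K \<Longrightarrow> 0 \<le> u j v"
        "\<And>j. (\<Sum>v\<in>z ` K. u j v *\<^sub>R v) = z j" by metis
    \<comment> \<open>Undoes the normalization: \<open>s j\<close> restores the target column, and
      division by \<open>s k\<close> compensates for using the original column
      \<open>k\<close>.\<close>
    let ?H = "\<lambda>k j. s j * u j (z k) / s k"
    have nonneg: "0 \<le> ?H k j" if "k \<in> K" for k j
      using u(1) s that by (simp add: less_imp_le)
    have combination: "column j M = (\<Sum>k\<in>K. ?H k j *\<^sub>R column k M)" for j
    proof -
      have "z j = (\<Sum>k\<in>K. u j (z k) *\<^sub>R z k)"
        using u(2)[of j] K(1) by (simp add: sum.reindex)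
      then have "column j M = s j *\<^sub>R (\<Sum>k\<in>K. u j (z k) *\<^sub>R z k)" by (simp add: Mz)
      then show ?thesis using s by (simp add: scaleR_sum_right zM field_simps less_imp_neq)
    qed
    show "\<exists>H. (\<forall>k\<in>K. \<forall>j. 0 \<le> H k j) \<and> M = cols_mult M K H"
      unfolding cols_mult_iff
      by (intro exI[of _ ?H] conjI ballI allI nonneg) (assumption, rule combination)
  qed
qed

end
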